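(* Let $(\mathcal{L},T_* )$ be a real-valued logic. Then $\mathcal{L}$ satisfies principle (P1) if, and only if, $\mathcal{L}$ is an extension of G\"odel logic $\mathbf{G}$.
   Context: Formulas $\mathrm{Form}$ are built from countably many propositional variables $X_1,X_2,\dots$ with primitive connectives $\to$, $\&$, $\bot$; abbreviations: $\neg\alpha:=\alpha\to\bot$, $\alpha\wedge\beta:=\alpha\&(\alpha\to\beta)$, $\alpha\vee\beta:=((\alpha\to\beta)\to\beta)\wedge((\beta\to\alpha)\to\alpha)$, $\alpha\leftrightarrow\beta:=(\alpha\to\beta)\&(\beta\to\alpha)$. $\mathbf{BL}$ is H\'ajek's Basic Logic (the logic of all continuous t-norms and their residua). An extension of $\mathbf{BL}$ is a consistent set of formulas closed under the consequence relation of $\mathbf{BL}$ and under substitutions. A t-norm here is a continuous, associative, commutative binary operation $*$ on $[0,1]$ with neutral element $1$, non-decreasing in each argument; its residuum is $a\to_* b:=\max\{c\in[0,1]: a*c\le b\}$. An algebra of truth values $T_*$ is a subalgebra (containing $0,1$, closed under $*$ and $\to_*$) of a BL-algebra $([0,1],*,\to_*,0)$ with $*$ a continuous t-norm; valuations $\mu:\mathrm{Form}\to T_*$ interpret $\&$ by $*$, $\to$ by $\to_*$, $\bot$ by $0$. A pair $(\mathcal{L},T_* )$ is a real-valued logic if $\mathcal{L}$ is an extension of $\mathbf{BL}$ complete with respect to valuations into $T_*$ (i.e. $\vdash_{\mathcal{L}}\alpha$ iff $\mu(\alpha)=1$ for all valuations $\mu$ into $T_*$); any such $T_*$ is said to induce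 $\mathcal{L}$. G\"odel logic $\mathbf{G}$ is $\mathbf{BL}$ extended by the schema $\varphi\to(\varphi\&\varphi)$. Principle (P1) for $\mathcal{L}$: for every algebra of truth values $T_*$ inducing $\mathcal{L}$ and all $\alpha,\beta\in\mathrm{Form}$, $\vdash_{\mathcal{L}}\alpha\leftrightarrow\beta$ holds if and only if for every valuation $\mu:\mathrm{Form}\to T_*$ one has ($\mu(\alpha)=1\iff\mu(\beta)=1$). *)

theory Defs
  imports "HOL-Analysis.Analysis"
begin

datatype form =
    Var nat
  | Bot
  | Imp form form  (infixr "\<^bold>\<rightarrow>" 55)
  | Conj form form  (infixr "\<^bold>&" 60)

definition Iff :: "form \<Rightarrow> form \<Rightarrow> form"  (infix "\<^bold>\<leftrightarrow>" 52) where
  "\<alpha> \<^bold>\<leftrightarrow> \<beta> = (\<alpha> \<^bold>\<rightarrow> \<beta>) \<^bold>& (\<beta> \<^bold>\<rightarrow> \<alpha>)"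

primrec subst_form :: "(nat \<Rightarrow> form) \<Rightarrow> form \<Rightarrow> form" where
  "subst_form \<sigma> (Var n) = \<sigma> n"
| "subst_form \<sigma> Bot = Bot"
| "subst_form \<sigma> (\<alpha> \<^bold>\<rightarrow> \<beta>) = subst_form \<sigma> \<alpha> \<^bold>\<rightarrow> subst_form \<sigma> \<beta>"
| "subst_form \<sigma> (\<alpha> \<^bold>& \<beta>) = subst_form \<sigma> \<alpha> \<^bold>& subst_form \<sigma> \<beta>"

text \<open>The consequence relation of BL is derivability in Hajek's calculus: his axiom schemata
  (A1)--(A7), with modus ponens as the only rule.\<close>

inductive BL_axiom :: "form \<Rightarrow> bool" where
  A1: "BL_axiom ((\<phi> \<^bold>\<rightarrow> \<psi>) \<^bold>\<rightarrow> ((\<psi> \<^bold>\<rightarrow> \<theta>) \<^bold>\<rightarrow> (\<phi> \<^bold>\<rightarrow> \<theta>)))"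
| A2: "BL_axiom ((\<phi> \<^bold>& \<psi>) \<^bold>\<rightarrow> \<phi>)"
| A3: "BL_axiom ((\<phi> \<^bold>& \<psi>) \<^bold>\<rightarrow> (\<psi> \<^bold>& \<phi>))"
| A4: "BL_axiom ((\<phi> \<^bold>& (\<phi> \<^bold>\<rightarrow> \<psi>)) \<^bold>\<rightarrow> (\<psi> \<^bold>& (\<psi> \<^bold>\<rightarrow> \<phi>)))"
| A5a: "BL_axiom ((\<phi> \<^bold>\<rightarrow> (\<psi> \<^bold>\<rightarrow> \<theta>)) \<^bold>\<rightarrow> ((\<phi> \<^bold>& \<psi>) \<^bold>\<rightarrow> \<theta>))"
| A5b: "BL_axiom (((\<phi> \<^bold>& \<psi>) \<^bold>\<rightarrow> \<theta>) \<^bold>\<rightarrow> (\<phi> \<^bold>\<rightarrow> (\<psi> \<^bold>\<rightarrow> \<theta>)))"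
| A6: "BL_axiom (((\<phi> \<^bold>\<rightarrow> \<psi>) \<^bold>\<rightarrow> \<theta>) \<^bold>\<rightarrow> (((\<psi> \<^bold>\<rightarrow> \<phi>) \<^bold>\<rightarrow> \<theta>) \<^bold>\<rightarrow> \<theta>))"
| A7: "BL_axiom (Bot \<^bold>\<rightarrow> \<phi>)"

inductive BL_derives :: "form set \<Rightarrow> form \<Rightarrow> bool" for \<Gamma> where
  premise: "\<phi> \<in> \<Gamma> \<Longrightarrow> BL_derives \<Gamma> \<phi>"
| axiom: "BL_axiom \<phi> \<Longrightarrow> BL_derives \<Gamma> \<phi>"
| mp: "BL_derives \<Gamma> \<phi> \<Longrightarrow> BL_derives \<Gamma> (\<phi> \<^bold>\<rightarrow> \<psi>) \<Longrightarrow> BL_derives \<Gamma> \<psi>"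

definition G_derives :: "form set \<Rightarrow> form \<Rightarrow> bool" where
  "G_derives \<Gamma> = BL_derives (\<Gamma> \<union> {\<phi> \<^bold>\<rightarrow> (\<phi> \<^bold>& \<phi>) | \<phi>. True})"

definition extension_of :: "(form set \<Rightarrow> form \<Rightarrow> bool) \<Rightarrow> form set \<Rightarrow> bool" where
  "extension_of derives L \<longleftrightarrow>
     Bot \<notin> L \<and>
     (\<forall>\<phi>. derives L \<phi> \<longrightarrow> \<phi> \<in> L) \<and>
     (\<forall>\<sigma>. \<forall>\<phi>\<in>L. subst_form \<sigma> \<phi> \<in> L)"

text \<open>Operations on the unit interval are total functions on the reals; only their values on
  the unit interval are constrained or used.\<close>

definition continuous_tnorm :: "(real \<Rightarrow> real \<Rightarrow> real) \<Rightarrow> bool" where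
  "continuous_tnorm tn \<longleftrightarrow>
     (\<forall>a\<in>{0..1}. \<forall>b\<in>{0..1}. tn a b \<in> {0..1}) \<and>
     continuous_on ({0..1} \<times> {0..1}) (\<lambda>(a, b). tn a b) \<and>
     (\<forall>a\<in>{0..1}. \<forall>b\<in>{0..1}. \<forall>c\<in>{0..1}. tn (tn a b) c = tn a (tn b c)) \<and>
     (\<forall>a\<in>{0..1}. \<forall>b\<in>{0..1}. tn a b = tn b a) \<and>
     (\<forall>a\<in>{0..1}. tn a 1 = a) \<and>
     (\<forall>a\<in>{0..1}. \<forall>a'\<in>{0..1}. \<forall>b\<in>{0..1}. \<forall>b'\<in>{0..1}.
        a \<le> a' \<longrightarrow> b \<le> b' \<longrightarrow> tn a b \<le> tn a' b')"

definition residuum :: "(real \<Rightarrow> real \<Rightarrow> real) \<Rightarrow> real \<Rightarrow> real \<Rightarrow> real" where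
  "residuum tn a b = (GREATEST c. c \<in> {0..1} \<and> tn a c \<le> b)"

definition truth_algebra :: "(real \<Rightarrow> real \<Rightarrow> real) \<Rightarrow> real set \<Rightarrow> bool" where
  "truth_algebra tn T \<longleftrightarrow>
     continuous_tnorm tn \<and> T \<subseteq> {0..1} \<and> 0 \<in> T \<and> 1 \<in> T \<and>
     (\<forall>a\<in>T. \<forall>b\<in>T. tn a b \<in> T \<and> residuum tn a b \<in> T)"

definition valuation :: "(real \<Rightarrow> real \<Rightarrow> real) \<Rightarrow> real set \<Rightarrow> (form \<Rightarrow> real) \<Rightarrow> bool" where
  "valuation tn T \<mu> \<longleftrightarrow>
     (\<forall>\<phi>. \<mu> \<phi> \<in> T) \<and>
     \<mu> Bot = 0 \<and>
     (\<forall>\<alpha> \<beta>. \<mu> (\<alpha> \<^bold>& \<beta>) = tn (\<mu> \<alpha>) (\<mu> \<beta>)) \<and>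
     (\<forall>\<alpha> \<beta>. \<mu> (\<alpha> \<^bold>\<rightarrow> \<beta>) = residuum tn (\<mu> \<alpha>) (\<mu> \<beta>))"

definition real_valued_logic :: "form set \<Rightarrow> (real \<Rightarrow> real \<Rightarrow> real) \<Rightarrow> real set \<Rightarrow> bool" where
  "real_valued_logic L tn T \<longleftrightarrow>
     extension_of BL_derives L \<and> truth_algebra tn T \<and>
     (\<forall>\<alpha>. \<alpha> \<in> L \<longleftrightarrow> (\<forall>\<mu>. valuation tn T \<mu> \<longrightarrow> \<mu> \<alpha> = 1))"

definition P1 :: "form set \<Rightarrow> bool" where
  "P1 L \<longleftrightarrow>
     (\<forall>tn T. real_valued_logic L tn T \<longrightarrow>
        (\<forall>\<alpha> \<beta>. (\<alpha> \<^bold>\<leftrightarrow> \<beta>) \<in> L \<longleftrightarrow>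
           (\<forall>\<mu>. valuation tn T \<mu> \<longrightarrow> (\<mu> \<alpha> = 1 \<longleftrightarrow> \<mu> \<beta> = 1))))"

end

theory Submission
  imports Defs
begin

text \<open>
  Both sides say that every element of an inducing algebra is idempotent. As \<open>a * a = 1\<close> holds only
  for \<open>a = 1\<close>, principle (P1) identifies \<open>X\<close> with \<open>X & X\<close>, which is contraction. Conversely, if
  \<open>t > 0\<close> is idempotent for a continuous t-norm, then sending the up-set of \<open>t\<close> to \<open>1\<close> and fixing
  everything below \<open>t\<close> preserves the t-norm and its residuum. Hence if \<open>\<mu> \<alpha> < \<mu> \<beta>\<close> and
  \<open>t = \<mu> \<beta>\<close> is idempotent, composing \<open>\<mu>\<close> with this map yields a valuation with value \<open>1\<close> at
  \<open>\<beta>\<close> but not at \<open>\<alpha>\<close>.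
\<close>

definition collapse :: "real \<Rightarrow> real \<Rightarrow> real" where
  "collapse t x = (if t \<le> x then 1 else x)"

locale standard_BL_algebra =
  fixes tn :: "real \<Rightarrow> real \<Rightarrow> real"  (infixl "\<otimes>" 70)
  assumes continuous_tnorm: "continuous_tnorm tn"
begin

abbreviation residuum_op :: "real \<Rightarrow> real \<Rightarrow> real"  (infixr "\<leadsto>" 65) where
  "a \<leadsto> b \<equiv> residuum tn a b"

lemma tnorm_range: "a \<in> {0..1} \<Longrightarrow> b \<in> {0..1} \<Longrightarrow> a \<otimes> b \<in> {0..1}"
  and tnorm_continuous_on: "continuous_on ({0..1} \<times> {0..1}) (\<lambda>(a, b). a \<otimes> b)"
  and tnorm_assoc:
    "a \<in> {0..1} \<Longrightarrow> b \<in> {0..1} \<Longrightarrow> c \<in> {0..1} \<Longrightarrow> a \<otimes> b \<otimes> c = a \<otimes> (b \<otimes> c)"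
  and tnorm_commute: "a \<in> {0..1} \<Longrightarrow> b \<in> {0..1} \<Longrightarrow> a \<otimes> b = b \<otimes> a"
  and tnorm_one_right: "a \<in> {0..1} \<Longrightarrow> a \<otimes> 1 = a"
  and tnorm_mono: "a \<in> {0..1} \<Longrightarrow> a' \<in> {0..1} \<Longrightarrow> b \<in> {0..1} \<Longrightarrow> b' \<in> {0..1} \<Longrightarrow>
    a \<le> a' \<Longrightarrow> b \<le> b' \<Longrightarrow> a \<otimes> b \<le> a' \<otimes> b'"
  using continuous_tnorm unfolding continuous_tnorm_def by blast+

lemma tnorm_one_left: "a \<in> {0..1} \<Longrightarrow> 1 \<otimes> a = a"
  using tnorm_commute[of 1 a] tnorm_one_right by simp

lemma tnorm_le_left: "a \<in> {0..1} \<Longrightarrow> b \<in> {0..1} \<Longrightarrow> a \<otimes> b \<le> a"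
  using tnorm_mono[of a a b 1] tnorm_one_right by simp

lemma tnorm_le_right: "a \<in> {0..1} \<Longrightarrow> b \<in> {0..1} \<Longrightarrow> a \<otimes> b \<le> b"
  using tnorm_le_left[of b a] tnorm_commute by simp

lemma tnorm_zero_right: "a \<in> {0..1} \<Longrightarrow> a \<otimes> 0 = 0"
  using tnorm_le_right[of a 0] tnorm_range[of a 0] by simp

lemma tnorm_eq_one_iff:
  assumes "a \<in> {0..1}" "b \<in> {0..1}"
  shows "a \<otimes> b = 1 \<longleftrightarrow> a = 1 \<and> b = 1"
  using tnorm_le_left[OF assms] tnorm_le_right[OF assms] tnorm_one_right[of 1] assms by auto

lemma tnorm_continuous_on_right:
  assumes "a \<in> {0..1}"
  shows "continuous_on {0..1} (\<lambda>c. a \<otimes> c)"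
proof -
  have "continuous_on {0..1} ((\<lambda>(x, y). x \<otimes> y) \<circ> (\<lambda>c. (a, c)))"
    by (intro continuous_on_compose continuous_intros
        continuous_on_subset[OF tnorm_continuous_on]) (use assms in auto)
  then show ?thesis
    by (simp add: o_def)
qed

lemma tnorm_divisible:
  assumes "a \<in> {0..1}" "b \<in> {0..1}" "b \<le> a"
  obtains c where "c \<in> {0..1}" "a \<otimes> c = b"
  using IVT'[of "\<lambda>c. a \<otimes> c" 0 b 1] tnorm_continuous_on_right[OF assms(1)]
    tnorm_zero_right[OF assms(1)] tnorm_one_right[OF assms(1)] assms by auto

lemma tnorm_idempotent_left:
  assumes "a \<in> {0..1}" "b \<in> {0..1}" and idem: "a \<otimes> a = a"
  shows "a \<otimes> b = min a b"
proof (cases "a \<le> b")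
  case True
  then have "a \<otimes> b = a"
    using tnorm_mono[of a a a b] tnorm_le_left[of a b] assms by simp
  with True show ?thesis
    by simp
next
  case False
  then obtain c where c: "c \<in> {0..1}" "a \<otimes> c = b"
    using tnorm_divisible[OF assms(1,2)] by auto
  have "a \<otimes> b = a \<otimes> a \<otimes> c"
    using tnorm_assoc c assms(1) by simp
  also have "\<dots> = b"
    using idem c by simp
  finally show ?thesis
    using False by simp
qed

lemma
  assumes "a \<in> {0..1}" "b \<in> {0..1}"
  shows residuum_range: "a \<leadsto> b \<in> {0..1}"
    and tnorm_residuum_le: "a \<otimes> (a \<leadsto> b) \<le> b"
    and residuum_greatest: "c \<in> {0..1} \<Longrightarrow> a \<otimes> c \<le> b \<Longrightarrow> c \<le> a \<leadsto> b"
proof -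
  let ?S = "{c \<in> {0..1}. a \<otimes> c \<le> b}"
  have "closed ?S"
    using continuous_closed_preimage[OF tnorm_continuous_on_right[OF assms(1)]
        closed_atLeastAtMost closed_atMost[of b]]
    by (simp add: vimage_def Int_def)
  moreover have "bounded ?S"
    by (rule bounded_subset[of "{0..1}"]) auto
  ultimately have "compact ?S"
    by (simp add: compact_eq_bounded_closed)
  moreover have "0 \<in> ?S"
    using tnorm_zero_right assms by simp
  ultimately obtain m where m: "m \<in> ?S" "\<forall>c\<in>?S. c \<le> m"
    using compact_attains_sup[of ?S] by blast
  then have "a \<leadsto> b = m"
    unfolding residuum_def by (intro Greatest_equality) auto
  with m show "a \<leadsto> b \<in> {0..1}" "a \<otimes> (a \<leadsto> b) \<le> b"
    and "c \<in> {0..1} \<Longrightarrow> a \<otimes> c \<le> b \<Longrightarrow> c \<le> a \<leadsto> b"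
    by auto
qed

lemma le_residuum_iff:
  assumes "a \<in> {0..1}" "b \<in> {0..1}" "c \<in> {0..1}"
  shows "c \<le> a \<leadsto> b \<longleftrightarrow> a \<otimes> c \<le> b"
proof
  assume "c \<le> a \<leadsto> b"
  then have "a \<otimes> c \<le> a \<otimes> (a \<leadsto> b)"
    using tnorm_mono residuum_range[OF assms(1,2)] assms by blast
  also have "\<dots> \<le> b"
    using tnorm_residuum_le[OF assms(1,2)] .
  finally show "a \<otimes> c \<le> b" .
next
  assume "a \<otimes> c \<le> b"
  then show "c \<le> a \<leadsto> b"
    using residuum_greatest[OF assms] by blast
qed

lemma residuum_eq_one_iff:
  assumes "a \<in> {0..1}" "b \<in> {0..1}"
  shows "a \<leadsto> b = 1 \<longleftrightarrow> a \<le> b"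
  using le_residuum_iff[OF assms, of 1] residuum_range[OF assms]
    tnorm_one_right[OF assms(1)] by auto

lemma residuum_ge: "a \<in> {0..1} \<Longrightarrow> b \<in> {0..1} \<Longrightarrow> b \<le> a \<leadsto> b"
  by (simp only: le_residuum_iff tnorm_le_right)

lemma residuum_one_left:
  assumes "b \<in> {0..1}"
  shows "1 \<leadsto> b = b"
proof (rule antisym)
  show "1 \<leadsto> b \<le> b"
    using residuum_range[OF _ assms, of 1] tnorm_residuum_le[OF _ assms, of 1]
      tnorm_one_left[of "1 \<leadsto> b"] by simp
  show "b \<le> 1 \<leadsto> b"
    using residuum_ge assms by simp
qed

context
  fixes t :: real
  assumes idempotent_range: "t \<in> {0..1}" and idempotent: "t \<otimes> t = t"
begin

lemma tnorm_across_idempotent: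
  assumes "a \<in> {0..1}" "b \<in> {0..1}" "b \<le> t" "t \<le> a"
  shows "a \<otimes> b = b"
proof (rule antisym)
  show "a \<otimes> b \<le> b"
    using tnorm_le_right assms by blast
  have "b = t \<otimes> b"
    using tnorm_idempotent_left[OF idempotent_range _ idempotent] assms by simp
  also have "\<dots> \<le> a \<otimes> b"
    using tnorm_mono idempotent_range assms by simp
  finally show "b \<le> a \<otimes> b" .
qed

lemma residuum_less_idempotent:
  assumes "a \<in> {0..1}" "b \<in> {0..1}" "b < a" "b < t"
  shows "a \<leadsto> b < t"
proof (rule ccontr)
  assume "\<not> a \<leadsto> b < t"
  then have "a \<otimes> t \<le> b"
    using le_residuum_iff[OF assms(1,2) idempotent_range] by simp
  moreover have "a \<otimes> t = min t a"
    using tnorm_idempotent_left[OF idempotent_range _ idempotent] tnorm_commute idempotent_range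
      assms by simp
  ultimately show False
    using assms by simp
qed

lemma residuum_across_idempotent:
  assumes "a \<in> {0..1}" "b \<in> {0..1}" "b < t" "t \<le> a"
  shows "a \<leadsto> b = b"
proof (rule antisym)
  note range = residuum_range[OF assms(1,2)]
  have "a \<leadsto> b < t"
    using residuum_less_idempotent assms by simp
  then have "a \<otimes> (a \<leadsto> b) = a \<leadsto> b"
    using tnorm_across_idempotent range assms by simp
  then show "a \<leadsto> b \<le> b"
    using tnorm_residuum_le[OF assms(1,2)] by simp
  show "b \<le> a \<leadsto> b"
    using residuum_ge assms by blast
qed

lemma collapse_tnorm:
  assumes "a \<in> {0..1}" "b \<in> {0..1}"
  shows "collapse t (a \<otimes> b) = collapse t a \<otimes> collapse t b"
proof -
  consider (both_above) "t \<le> a" "t \<le> b" | (right_below) "t \<le> a" "b < t"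
    | (left_below) "a < t" "t \<le> b" | (both_below) "a < t" "b < t"
    by linarith
  then show ?thesis
  proof cases
    case both_above
    then have "t \<le> a \<otimes> b"
      using tnorm_mono[of t a t b] idempotent_range idempotent assms by simp
    with both_above show ?thesis
      using tnorm_one_right[of 1] by (simp add: collapse_def)
  next
    case right_below
    then show ?thesis
      using tnorm_across_idempotent[of a b] tnorm_one_left assms by (simp add: collapse_def)
  next
    case left_below
    then show ?thesis
      using tnorm_across_idempotent[of b a] tnorm_commute[of a b] tnorm_one_right assms
      by (simp add: collapse_def)
  next
    case both_below
    then show ?thesis
      using tnorm_le_left[of a b] assms by (simp add: collapse_def)
  qed
qed

lemma collapse_residuum:
  assumes "a \<in> {0..1}" "b \<in> {0..1}"
  shows "collapse t (a \<leadsto> b) = collapse t a \<leadsto> collapse t b"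
proof -
  consider (ordered) "a \<le> b" | (both_above) "b < a" "t \<le> b"
    | (right_below) "b < t" "t \<le> a" | (both_below) "b < a" "a < t"
    by linarith
  then show ?thesis
  proof cases
    case ordered
    then have "collapse t a \<le> collapse t b"
      using assms by (simp add: collapse_def)
    with ordered show ?thesis
      using residuum_eq_one_iff[of "collapse t a" "collapse t b"] residuum_eq_one_iff[of a b] assms
        idempotent_range
      by (auto simp: collapse_def)
  next
    case both_above
    then show ?thesis
      using residuum_ge[of a b] residuum_eq_one_iff[of 1 1] assms by (simp add: collapse_def)
  next
    case right_below
    then show ?thesis
      using residuum_across_idempotent residuum_one_left assms by (simp add: collapse_def)
  next
    case both_below
    then show ?thesis
      using residuum_less_idempotent[of a b] assms by (simp add: collapse_def)
  qed
qed

end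

end

primrec truth_value :: "(real \<Rightarrow> real \<Rightarrow> real) \<Rightarrow> (nat \<Rightarrow> real) \<Rightarrow> form \<Rightarrow> real" where
  "truth_value tn e (Var n) = e n"
| "truth_value tn e Bot = 0"
| "truth_value tn e (\<alpha> \<^bold>\<rightarrow> \<beta>) = residuum tn (truth_value tn e \<alpha>) (truth_value tn e \<beta>)"
| "truth_value tn e (\<alpha> \<^bold>& \<beta>) = tn (truth_value tn e \<alpha>) (truth_value tn e \<beta>)"

definition valid :: "(real \<Rightarrow> real \<Rightarrow> real) \<Rightarrow> real set \<Rightarrow> form \<Rightarrow> bool" where
  "valid tn T \<phi> \<longleftrightarrow> (\<forall>\<mu>. valuation tn T \<mu> \<longrightarrow> \<mu> \<phi> = 1)"

definition same_models :: "(real \<Rightarrow> real \<Rightarrow> real) \<Rightarrow> real set \<Rightarrow> form \<Rightarrow> form \<Rightarrow> bool" where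
  "same_models tn T \<alpha> \<beta> \<longleftrightarrow> (\<forall>\<mu>. valuation tn T \<mu> \<longrightarrow> (\<mu> \<alpha> = 1 \<longleftrightarrow> \<mu> \<beta> = 1))"

definition idempotent_on :: "(real \<Rightarrow> real \<Rightarrow> real) \<Rightarrow> real set \<Rightarrow> bool" where
  "idempotent_on tn T \<longleftrightarrow> (\<forall>a\<in>T. tn a a = a)"

locale truth_value_algebra =
  fixes tn :: "real \<Rightarrow> real \<Rightarrow> real"  (infixl "\<otimes>" 70) and T :: "real set"
  assumes truth_algebra: "truth_algebra tn T"
begin

sublocale standard_BL_algebra tn
  using truth_algebra by unfold_locales (simp add: truth_algebra_def)

lemma carrier_unit: "a \<in> T \<Longrightarrow> a \<in> {0..1}"
  and zero_in_carrier: "0 \<in> T"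
  and one_in_carrier: "1 \<in> T"
  and tnorm_closed: "a \<in> T \<Longrightarrow> b \<in> T \<Longrightarrow> a \<otimes> b \<in> T"
  and residuum_closed: "a \<in> T \<Longrightarrow> b \<in> T \<Longrightarrow> a \<leadsto> b \<in> T"
  using truth_algebra unfolding truth_algebra_def by blast+

lemma valuation_truth_value:
  assumes "\<And>n. e n \<in> T"
  shows "valuation tn T (truth_value tn e)"
proof -
  have "truth_value tn e \<phi> \<in> T" for \<phi>
    by (induction \<phi>) (simp_all add: assms zero_in_carrier tnorm_closed residuum_closed)
  then show ?thesis
    by (simp add: valuation_def)
qed

context
  fixes \<mu> :: "form \<Rightarrow> real"
  assumes valuation: "valuation tn T \<mu>"
begin

lemma valuation_in_carrier: "\<mu> \<phi> \<in> T"
  and valuation_Bot: "\<mu> Bot = 0"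
  and valuation_Conj: "\<mu> (\<alpha> \<^bold>& \<beta>) = \<mu> \<alpha> \<otimes> \<mu> \<beta>"
  and valuation_Imp: "\<mu> (\<alpha> \<^bold>\<rightarrow> \<beta>) = \<mu> \<alpha> \<leadsto> \<mu> \<beta>"
  using valuation unfolding valuation_def by blast+

lemma valuation_range: "\<mu> \<phi> \<in> {0..1}"
  by (intro carrier_unit valuation_in_carrier)

lemma valuation_Imp_eq_one_iff: "\<mu> (\<alpha> \<^bold>\<rightarrow> \<beta>) = 1 \<longleftrightarrow> \<mu> \<alpha> \<le> \<mu> \<beta>"
  by (simp only: valuation_Imp residuum_eq_one_iff valuation_range)

lemma valuation_Conj_eq_one_iff: "\<mu> (\<alpha> \<^bold>& \<beta>) = 1 \<longleftrightarrow> \<mu> \<alpha> = 1 \<and> \<mu> \<beta> = 1"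
  by (simp only: valuation_Conj tnorm_eq_one_iff valuation_range)

lemma valuation_Iff_eq_one_iff: "\<mu> (\<alpha> \<^bold>\<leftrightarrow> \<beta>) = 1 \<longleftrightarrow> \<mu> \<alpha> = \<mu> \<beta>"
  unfolding Iff_def valuation_Conj_eq_one_iff valuation_Imp_eq_one_iff by auto

lemma valuation_collapse:
  assumes "t \<in> {0..1}" "t \<otimes> t = t" "0 < t"
  shows "valuation tn T (collapse t \<circ> \<mu>)"
proof -
  have "collapse t (\<mu> \<phi>) \<in> T" for \<phi>
    using valuation_in_carrier one_in_carrier by (simp add: collapse_def)
  moreover have "collapse t 0 = 0"
    using \<open>0 < t\<close> by (simp add: collapse_def)
  ultimately show ?thesis
    using collapse_tnorm[OF assms(1,2)] collapse_residuum[OF assms(1,2)] valuation_range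
    by (simp add: valuation_def valuation_Bot valuation_Conj valuation_Imp)
qed

lemma valuation_le_if_models_subset:
  assumes idem: "\<mu> \<beta> \<otimes> \<mu> \<beta> = \<mu> \<beta>"
    and models: "\<And>\<nu>. valuation tn T \<nu> \<Longrightarrow> \<nu> \<beta> = 1 \<Longrightarrow> \<nu> \<alpha> = 1"
  shows "\<mu> \<beta> \<le> \<mu> \<alpha>"
proof (rule ccontr)
  assume less: "\<not> \<mu> \<beta> \<le> \<mu> \<alpha>"
  then have "0 < \<mu> \<beta>"
    using valuation_range[of \<alpha>] by simp
  then have "collapse (\<mu> \<beta>) (\<mu> \<alpha>) = 1"
    using models[OF valuation_collapse[OF valuation_range idem]] by (simp add: collapse_def)
  then show False
    using less valuation_range[of \<beta>] by (auto simp: collapse_def)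
qed

end

lemma valid_Imp_iff: "valid tn T (\<alpha> \<^bold>\<rightarrow> \<beta>) \<longleftrightarrow> (\<forall>\<mu>. valuation tn T \<mu> \<longrightarrow> \<mu> \<alpha> \<le> \<mu> \<beta>)"
  by (simp add: valid_def valuation_Imp_eq_one_iff)

lemma valid_Iff_iff: "valid tn T (\<alpha> \<^bold>\<leftrightarrow> \<beta>) \<longleftrightarrow> (\<forall>\<mu>. valuation tn T \<mu> \<longrightarrow> \<mu> \<alpha> = \<mu> \<beta>)"
  by (simp add: valid_def valuation_Iff_eq_one_iff)

lemma valid_contraction_iff_idempotent_on:
  "(\<forall>\<phi>. valid tn T (\<phi> \<^bold>\<rightarrow> \<phi> \<^bold>& \<phi>)) \<longleftrightarrow> idempotent_on tn T"
proof
  assume contraction: "\<forall>\<phi>. valid tn T (\<phi> \<^bold>\<rightarrow> \<phi> \<^bold>& \<phi>)"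
  have "a \<otimes> a = a" if "a \<in> T" for a
  proof (rule antisym)
    show "a \<otimes> a \<le> a"
      using tnorm_le_left carrier_unit that by blast
    have "valuation tn T (truth_value tn (\<lambda>_. a))"
      using valuation_truth_value that by simp
    then have "truth_value tn (\<lambda>_. a) (Var 0) \<le> truth_value tn (\<lambda>_. a) (Var 0 \<^bold>& Var 0)"
      using contraction valid_Imp_iff by blast
    then show "a \<le> a \<otimes> a"
      by simp
  qed
  then show "idempotent_on tn T"
    by (simp add: idempotent_on_def)
next
  assume "idempotent_on tn T"
  then show "\<forall>\<phi>. valid tn T (\<phi> \<^bold>\<rightarrow> \<phi> \<^bold>& \<phi>)"
    by (simp add: valid_Imp_iff valuation_Conj valuation_in_carrier idempotent_on_def)
qed

lemma valid_Iff_iff_same_models: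
  assumes "idempotent_on tn T"
  shows "valid tn T (\<alpha> \<^bold>\<leftrightarrow> \<beta>) \<longleftrightarrow> same_models tn T \<alpha> \<beta>"
proof
  assume "valid tn T (\<alpha> \<^bold>\<leftrightarrow> \<beta>)"
  then show "same_models tn T \<alpha> \<beta>"
    by (auto simp: valid_Iff_iff same_models_def)
next
  assume same: "same_models tn T \<alpha> \<beta>"
  have "\<mu> \<alpha> = \<mu> \<beta>" if \<mu>: "valuation tn T \<mu>" for \<mu>
  proof -
    have "\<mu> \<phi> \<otimes> \<mu> \<phi> = \<mu> \<phi>" for \<phi>
      using assms valuation_in_carrier[OF \<mu>] by (simp add: idempotent_on_def)
    then show ?thesis
      using same by (intro antisym valuation_le_if_models_subset \<mu>) (auto simp: same_models_def)
  qed
  then show "valid tn T (\<alpha> \<^bold>\<leftrightarrow> \<beta>)"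
    by (simp add: valid_Iff_iff)
qed

lemma same_models_principle_iff_idempotent_on:
  "(\<forall>\<alpha> \<beta>. valid tn T (\<alpha> \<^bold>\<leftrightarrow> \<beta>) \<longleftrightarrow> same_models tn T \<alpha> \<beta>) \<longleftrightarrow> idempotent_on tn T"
proof
  assume principle: "\<forall>\<alpha> \<beta>. valid tn T (\<alpha> \<^bold>\<leftrightarrow> \<beta>) \<longleftrightarrow> same_models tn T \<alpha> \<beta>"
  have "same_models tn T \<phi> (\<phi> \<^bold>& \<phi>)" for \<phi>
    by (simp add: same_models_def valuation_Conj_eq_one_iff)
  then have "valid tn T (\<phi> \<^bold>\<leftrightarrow> \<phi> \<^bold>& \<phi>)" for \<phi>
    using principle by blast
  then have "valid tn T (\<phi> \<^bold>\<rightarrow> \<phi> \<^bold>& \<phi>)" for \<phi>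
    unfolding valid_Iff_iff valid_Imp_iff by (metis order_refl)
  then show "idempotent_on tn T"
    using valid_contraction_iff_idempotent_on by blast
next
  assume "idempotent_on tn T"
  then show "\<forall>\<alpha> \<beta>. valid tn T (\<alpha> \<^bold>\<leftrightarrow> \<beta>) \<longleftrightarrow> same_models tn T \<alpha> \<beta>"
    using valid_Iff_iff_same_models by blast
qed

end

lemma
  assumes "real_valued_logic L tn T"
  shows real_valued_logic_extension: "extension_of BL_derives L"
    and real_valued_logic_algebra: "truth_value_algebra tn T"
    and real_valued_logic_complete: "\<phi> \<in> L \<longleftrightarrow> valid tn T \<phi>"
  using assms by (simp_all add: real_valued_logic_def truth_value_algebra_def valid_def)

lemma extension_of_G_derives_iff_contraction:
  "extension_of G_derives L \<longleftrightarrow>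
    extension_of BL_derives L \<and> (\<forall>\<phi>. (\<phi> \<^bold>\<rightarrow> \<phi> \<^bold>& \<phi>) \<in> L)"
proof (intro iffI conjI allI)
  assume extension: "extension_of G_derives L"
  have "G_derives L \<phi>" if "BL_derives L \<phi>" for \<phi>
    unfolding G_derives_def using that
    by induction (auto intro: BL_derives.intros)
  then show "extension_of BL_derives L"
    using extension unfolding extension_of_def by blast
  have "G_derives L (\<phi> \<^bold>\<rightarrow> \<phi> \<^bold>& \<phi>)" for \<phi>
    unfolding G_derives_def by (rule BL_derives.premise) auto
  then show "(\<phi> \<^bold>\<rightarrow> \<phi> \<^bold>& \<phi>) \<in> L" for \<phi>
    using extension unfolding extension_of_def by blast
next
  assume contraction: "extension_of BL_derives L \<and> (\<forall>\<phi>. (\<phi> \<^bold>\<rightarrow> \<phi> \<^bold>& \<phi>) \<in> L)"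
  then have "L \<union> {\<phi> \<^bold>\<rightarrow> (\<phi> \<^bold>& \<phi>) | \<phi>. True} = L"
    by auto
  then have "G_derives L = BL_derives L"
    by (simp add: G_derives_def)
  then show "extension_of G_derives L"
    using contraction by (simp add: extension_of_def)
qed

lemma extension_of_G_derives_iff_idempotent_on:
  assumes "real_valued_logic L tn T"
  shows "extension_of G_derives L \<longleftrightarrow> idempotent_on tn T"
  using truth_value_algebra.valid_contraction_iff_idempotent_on
    real_valued_logic_algebra[OF assms] real_valued_logic_extension[OF assms]
  by (simp add: extension_of_G_derives_iff_contraction real_valued_logic_complete[OF assms])

lemma P1_iff_idempotent_on:
  "P1 L \<longleftrightarrow> (\<forall>tn T. real_valued_logic L tn T \<longrightarrow> idempotent_on tn T)"
proof -
  have "(\<forall>\<alpha> \<beta>. (\<alpha> \<^bold>\<leftrightarrow> \<beta>) \<in> L \<longleftrightarrow> same_models tn T \<alpha> \<beta>) \<longleftrightarrow> idempotent_on tn T"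
    if "real_valued_logic L tn T" for tn T
    using truth_value_algebra.same_models_principle_iff_idempotent_on
      real_valued_logic_algebra[OF that]
    by (simp add: real_valued_logic_complete[OF that])
  then show ?thesis
    by (simp add: P1_def flip: same_models_def)
qed

theorem theoremI:
  fixes L :: "form set" and tn :: "real \<Rightarrow> real \<Rightarrow> real" and T :: "real set"
  assumes "real_valued_logic L tn T"
  shows "P1 L \<longleftrightarrow> extension_of G_derives L"
proof
  assume "P1 L"
  then have "idempotent_on tn T"
    using assms by (simp add: P1_iff_idempotent_on)
  then show "extension_of G_derives L"
    using extension_of_G_derives_iff_idempotent_on[OF assms] by simp
next
  assume "extension_of G_derives L"
  then show "P1 L"
    unfolding P1_iff_idempotent_on using extension_of_G_derives_iff_idempotent_on by blast
qed

end
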